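(* Let $m\ge t\ge 0$ and $s\ge 1$ be integers and let $\boldsymbol{x}_i\in[0,1)^s$, $i\in\{0,1,\dots,2^m-1\}$, be a $(t,m,s)$-net in base $2$. Then for every nonempty $u\subseteq\{1,\dots,s\}$ and every $\boldsymbol{k}\in\mathbb{N}_0^{|u|}$, the gain coefficient satisfies $$\Gamma_{u,\boldsymbol{k}}\le 2^{t+|u|-1}.$$
   Context: $\mathbb{N}_0$ is the set of non-negative integers. A sequence $\boldsymbol{x}_0,\dots,\boldsymbol{x}_{2^m-1}\in[0,1)^s$ is a $(t,m,s)$-net in base $2$ if for all $\boldsymbol{k}\in\mathbb{N}_0^s$ with $|\boldsymbol{k}|:=\sum_{j=1}^s k_j\le m-t$ and all integers $c_1,\dots,c_s$ with $0\le c_j<2^{k_j}$, the box $\prod_{j=1}^s[c_j2^{-k_j},(c_j+1)2^{-k_j})$ contains exactly $2^{m-|\boldsymbol{k}|}$ of the points (counted by index). Gain coefficients (base $2$): for points $\boldsymbol{x}_0,\dots,\boldsymbol{x}_{n-1}\in[0,1)^s$ with $n=2^m$, write $x_{ij}$ for the $j$-th coordinate of $\boldsymbol{x}_i$. For $x,x'\in[0,1)$ let $M(x,x')=\max\{k\in\mathbb{N}_0: \lfloor 2^kx\rfloor=\lfloor 2^kx'\rfloor\}\in\mathbb{N}_0\cup\{\infty\}$ (equal to $\infty$ when $x=x'$). For nonempty $u\subseteq\{1,\dots,s\}$ and $\boldsymbol{k}=(k_j)_{j\in u}\in\mathbb{N}_0^{|u|}$, put $N_{i,i',j}=0$ if $M(x_{ij},x_{i'j})<k_j$,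 $N_{i,i',j}=-1$ if $M(x_{ij},x_{i'j})=k_j$, and $N_{i,i',j}=1$ if $M(x_{ij},x_{i'j})>k_j$. Then $$\Gamma_{u,\boldsymbol{k}}=\frac1n\sum_{i=0}^{n-1}\sum_{i'=0}^{n-1}\prod_{j\in u}N_{i,i',j}.$$ *)

theory Defs
  imports Complex_Main "HOL-Library.Extended_Nat"
begin

text \<open>
  A family of points in $[0,1)^s$ is a function \<open>x :: nat \<Rightarrow> nat \<Rightarrow> real\<close>: \<open>x i j\<close> is the
  \<open>j\<close>-th coordinate of the \<open>i\<close>-th point, with coordinates indexed by \<open>{1..s}\<close> and points
  indexed from \<open>0\<close>. Values outside these ranges are irrelevant. Multi-indices are likewise
  functions \<open>nat \<Rightarrow> nat\<close> of which only the values on the relevant index set matter.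
\<close>

definition elementary_box :: "nat \<Rightarrow> (nat \<Rightarrow> nat) \<Rightarrow> (nat \<Rightarrow> int) \<Rightarrow> (nat \<Rightarrow> real) set" where
  "elementary_box s k c =
     {y. \<forall>j\<in>{1..s}. y j \<in> {of_int (c j) / 2 ^ k j ..< (of_int (c j) + 1) / 2 ^ k j}}"

text \<open>The condition \<open>|k| \<le> m - t\<close> is written without truncated subtraction.\<close>

definition tms_net :: "nat \<Rightarrow> nat \<Rightarrow> nat \<Rightarrow> (nat \<Rightarrow> nat \<Rightarrow> real) \<Rightarrow> bool" where
  "tms_net t m s x \<longleftrightarrow>
     (\<forall>i<2 ^ m. \<forall>j\<in>{1..s}. x i j \<in> {0..<1}) \<and>
     (\<forall>k :: nat \<Rightarrow> nat. (\<Sum>j=1..s. k j) + t \<le> m \<longrightarrow>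
        (\<forall>c :: nat \<Rightarrow> int. (\<forall>j\<in>{1..s}. 0 \<le> c j \<and> c j < 2 ^ k j) \<longrightarrow>
           card {i. i < 2 ^ m \<and> x i \<in> elementary_box s k c} = 2 ^ (m - (\<Sum>j=1..s. k j))))"

text \<open>
  The supremum in \<open>enat\<close> is the maximum of the set if \<open>x \<noteq> y\<close>, and \<open>\<infinity>\<close> if \<open>x = y\<close>;
  see the two lemmas below.
\<close>

definition match_depth :: "real \<Rightarrow> real \<Rightarrow> enat" where
  "match_depth x y = Sup (enat ` {k. \<lfloor>2 ^ k * x\<rfloor> = \<lfloor>2 ^ k * y\<rfloor>})"

definition gain_sign :: "real \<Rightarrow> real \<Rightarrow> nat \<Rightarrow> real" where
  "gain_sign x y k =
     (if match_depth x y < enat k then 0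
      else if match_depth x y = enat k then - 1
      else 1)"

definition gain_coeff ::
    "nat \<Rightarrow> (nat \<Rightarrow> nat \<Rightarrow> real) \<Rightarrow> nat set \<Rightarrow> (nat \<Rightarrow> nat) \<Rightarrow> real" where
  "gain_coeff n x u k =
     1 / real n * (\<Sum>i<n. \<Sum>i'<n. \<Prod>j\<in>u. gain_sign (x i j) (x i' j) (k j))"

lemma match_depth_refl: "match_depth x x = \<infinity>"
proof -
  have "infinite (range enat)"
    by (simp add: finite_image_iff inj_on_def)
  then show ?thesis
    by (simp add: match_depth_def Sup_enat_def)
qed

lemma match_depth_eq_Max:
  assumes "x \<in> {0..<1}" "y \<in> {0..<1}" "x \<noteq> y"
  defines "A \<equiv> {k :: nat. \<lfloor>2 ^ k * x\<rfloor> = \<lfloor>2 ^ k * y\<rfloor>}"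
  shows "finite A" "A \<noteq> {}" "match_depth x y = enat (Max A)"
proof -
  obtain n where n: "(1 / 2) ^ n < \<bar>x - y\<bar>"
    using real_arch_pow_inv[of "\<bar>x - y\<bar>" "1 / 2"] assms(3) by auto
  have "k < n" if "k \<in> A" for k
  proof (rule ccontr)
    assume "\<not> k < n"
    then have "(1 / 2 :: real) ^ k \<le> (1 / 2) ^ n"
      by (intro power_decreasing) auto
    then have "(1 / 2) ^ k < \<bar>x - y\<bar>"
      using n by (rule le_less_trans)
    then have "1 < 2 ^ k * \<bar>x - y\<bar>"
      by (simp add: power_one_over field_simps)
    also have "\<dots> = \<bar>2 ^ k * x - 2 ^ k * y\<bar>"
      by (simp add: abs_mult flip: right_diff_distrib)
    also have "\<dots> < 1"
      using that unfolding A_def by (simp, linarith)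
    finally show False .
  qed
  then show fin: "finite A"
    by (meson finite_nat_set_iff_bounded)
  have "0 \<in> A"
    using assms(1,2) floor_eq_iff[of x 0] floor_eq_iff[of y 0] by (simp add: A_def)
  then show ne: "A \<noteq> {}" by blast
  have "Max (enat ` A) = enat (Max A)"
    using fin ne by (intro mono_Max_commute[symmetric]) (auto simp: mono_def)
  then show "match_depth x y = enat (Max A)"
    using fin ne unfolding match_depth_def A_def[symmetric] by (simp add: Sup_enat_def)
qed

end

theory Submission
  imports Defs
begin

text \<open>
  Write $N = 2 \cdot 1[\mbox{agree to depth } k_j + 1] - 1[\mbox{agree to depth } k_j]$ and fix the
  first point $i$. If $|k| + |u| \le m - t$, expanding the product over $j \in u$ and counting the
  points of the boxes around $x_i$ gives
  $2^{m - |k|} \sum_{v \subseteq u} (-1)^{|u \setminus v|} = 0$ for the sum over $i'$.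
  Otherwise the sum over $i'$ is at most the number of points in the box of shape $k$ around $x_i$,
  which lies in a box of total depth $\min(|k|, m - t) \ge m - t - |u| + 1$.
\<close>

text \<open>The first \<open>l\<close> binary digits arise from the first \<open>k\<close> by
  integer division by \<open>2 ^ (k - l)\<close>, so the finer floor determines the coarser
  one.\<close>

lemma floor_power2_mono:
  fixes a b :: real
  assumes "\<lfloor>2 ^ k * a\<rfloor> = \<lfloor>2 ^ k * b\<rfloor>" "l \<le> k"
  shows "\<lfloor>2 ^ l * a\<rfloor> = \<lfloor>2 ^ l * b\<rfloor>"
proof -
  have "\<lfloor>2 ^ l * z\<rfloor> = \<lfloor>2 ^ k * z\<rfloor> div 2 ^ (k - l)" for z :: real
  proof -
    have "2 ^ l * z = 2 ^ k * z / real_of_int (2 ^ (k - l))"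
      using power_add[of "2 :: real" l "k - l"] assms(2) by (simp add: field_simps)
    then show ?thesis
      using floor_divide_real_eq_div[of "2 ^ (k - l)" "2 ^ k * z"] by simp
  qed
  then show ?thesis using assms(1) by simp
qed

text \<open>By \<open>floor_power2_mono\<close> the depths of agreement form a downward closed set,
  so comparing \<open>k\<close> with their supremum amounts to membership; this includes the value
  \<infinity>.\<close>

lemma le_match_depth_iff:
  assumes "a \<in> {0..<1}" "b \<in> {0..<1}"
  shows "enat k \<le> match_depth a b \<longleftrightarrow> \<lfloor>2 ^ k * a\<rfloor> = \<lfloor>2 ^ k * b\<rfloor>"
proof
  assume le: "enat k \<le> match_depth a b"
  show "\<lfloor>2 ^ k * a\<rfloor> = \<lfloor>2 ^ k * b\<rfloor>"
  proof (rule ccontr)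
    assume ne: "\<lfloor>2 ^ k * a\<rfloor> \<noteq> \<lfloor>2 ^ k * b\<rfloor>"
    have "\<lfloor>a\<rfloor> = 0" "\<lfloor>b\<rfloor> = 0"
      using assms by (simp_all add: floor_eq_iff)
    \<comment> \<open>Both floors vanish at depth 0, so the first disagreement lies deeper and
      \<open>k - 1\<close> is a genuine predecessor.\<close>
    then have "k \<noteq> 0" using ne by (cases k) auto
    have "match_depth a b \<le> enat (k - 1)"
      unfolding match_depth_def
    proof (rule Sup_least)
      fix e assume "e \<in> enat ` {k. \<lfloor>2 ^ k * a\<rfloor> = \<lfloor>2 ^ k * b\<rfloor>}"
      then obtain l where "e = enat l" "\<lfloor>2 ^ l * a\<rfloor> = \<lfloor>2 ^ l * b\<rfloor>" by blast
      then show "e \<le> enat (k - 1)"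
        using ne floor_power2_mono[of l a b k] by (cases "k \<le> l") auto
    qed
    then have "enat k \<le> enat (k - 1)" using le by (rule order_trans[rotated])
    then show False using \<open>k \<noteq> 0\<close> by simp
  qed
qed (auto simp: match_depth_def intro: Sup_upper)

text \<open>Turns the three cases into a linear combination of indicators, because sums of
  indicators over the points are what the net property can count.\<close>

lemma gain_sign_eq:
  assumes "a \<in> {0..<1}" "b \<in> {0..<1}"
  shows "gain_sign a b k =
    2 * of_bool (\<lfloor>2 ^ Suc k * a\<rfloor> = \<lfloor>2 ^ Suc k * b\<rfloor>) - of_bool (\<lfloor>2 ^ k * a\<rfloor> = \<lfloor>2 ^ k * b\<rfloor>)"
proof -
  have "match_depth a b = enat k \<longleftrightarrow>
      enat k \<le> match_depth a b \<and> \<not> enat (Suc k) \<le> match_depth a b"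
    by (cases "match_depth a b") auto
  moreover have "enat k \<le> match_depth a b" if "enat (Suc k) \<le> match_depth a b"
    using that by (cases "match_depth a b") auto
  ultimately show ?thesis
    unfolding gain_sign_def le_match_depth_iff[OF assms, symmetric]
    by (auto simp: not_less[symmetric])
qed

lemma prod_of_bool:
  assumes "finite A"
  shows "(\<Prod>j\<in>A. of_bool (P j)) = (of_bool (\<forall>j\<in>A. P j) :: real)"
  using assms by induction auto

text \<open>The points agreeing with point \<open>i\<close> to the depths \<open>l\<close> on
  \<open>u\<close> are those in one elementary box around it. Depth 0 off \<open>u\<close> imposes
  no condition, since all coordinates lie in [0,1).\<close>

lemma card_same_box:
  assumes net: "tms_net t m s x" and u: "u \<subseteq> {1..s}" and i: "i < 2 ^ m"
    and l: "sum l u + t \<le> m"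
  shows "card {i'. i' < 2 ^ m \<and> (\<forall>j\<in>u. \<lfloor>2 ^ l j * x i j\<rfloor> = \<lfloor>2 ^ l j * x i' j\<rfloor>)}
    = 2 ^ (m - sum l u)"
proof -
  define l' where "l' j = (if j \<in> u then l j else 0)" for j
  define c where "c j = \<lfloor>2 ^ l' j * x i j\<rfloor>" for j
  have range: "x p j \<in> {0..<1}" if "p < 2 ^ m" "j \<in> {1..s}" for p j
    using net that unfolding tms_net_def by blast
  have sum: "(\<Sum>j=1..s. l' j) = sum l u"
    unfolding l'_def using u by (simp add: sum.If_cases Int_absorb1)
  have "0 \<le> c j \<and> c j < 2 ^ l' j" if "j \<in> {1..s}" for j
    using range[OF i that] by (simp add: c_def floor_less_iff)
  then have "card {p. p < 2 ^ m \<and> x p \<in> elementary_box s l' c} = 2 ^ (m - sum l u)"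
    using net l unfolding tms_net_def sum[symmetric] by blast
  moreover have "x p \<in> elementary_box s l' c \<longleftrightarrow>
      (\<forall>j\<in>u. \<lfloor>2 ^ l j * x i j\<rfloor> = \<lfloor>2 ^ l j * x p j\<rfloor>)" if p: "p < 2 ^ m" for p
  proof -
    have "x p j \<in> {of_int (c j) / 2 ^ l' j ..< (of_int (c j) + 1) / 2 ^ l' j} \<longleftrightarrow>
        \<lfloor>2 ^ l' j * x p j\<rfloor> = c j" for j
      by (simp add: floor_eq_iff field_simps)
    then have "x p \<in> elementary_box s l' c \<longleftrightarrow> (\<forall>j\<in>{1..s}. \<lfloor>2 ^ l' j * x p j\<rfloor> = c j)"
      unfolding elementary_box_def by simp
    also have "\<dots> \<longleftrightarrow> (\<forall>j\<in>u. \<lfloor>2 ^ l' j * x p j\<rfloor> = c j)"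
    proof -
      have "\<lfloor>2 ^ l' j * x p j\<rfloor> = c j" if "j \<in> {1..s} - u" for j
      proof -
        have "\<lfloor>x i j\<rfloor> = 0" "\<lfloor>x p j\<rfloor> = 0"
          using that range[OF i, of j] range[OF p, of j] by (simp_all add: floor_eq_iff)
        then show ?thesis using that by (simp add: c_def l'_def)
      qed
      then show ?thesis using u by blast
    qed
    finally show ?thesis by (auto simp: c_def l'_def)
  qed
  ultimately show ?thesis by (simp cong: conj_cong)
qed

text \<open>Lowering a positive entry by one lowers the sum by one, so every smaller total is
  reached. This serves to coarsen a box until the net property applies to it.\<close>

lemma ex_le_with_sum:
  fixes k :: "'a \<Rightarrow> nat"
  assumes "finite A" "N \<le> sum k A"
  shows "\<exists>l. (\<forall>j. l j \<le> k j) \<and> sum l A = N"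
  using assms(2)
proof (induction "sum k A" arbitrary: k)
  case 0
  then show ?case by auto
next
  case (Suc n)
  show ?case
  proof (cases "N = sum k A")
    case False
    obtain a where a: "a \<in> A" "0 < k a"
      using Suc.hyps(2) by (metis gr0I sum.neutral nat.distinct(1))
    let ?k = "k(a := k a - 1)"
    have "sum ?k (A - {a}) = sum k (A - {a})" by (rule sum.cong) auto
    then have "Suc (sum ?k A) = sum k A"
      using a assms(1) by (simp add: sum.remove[of A a])
    then obtain l where "\<forall>j. l j \<le> ?k j" "sum l A = N"
      using Suc.hyps(1)[of ?k] Suc.hyps(2) Suc.prems False by auto
    moreover have "?k j \<le> k j" for j by simp
    ultimately show ?thesis by (blast intro: order_trans)
  qed auto
qed

lemma sum_gain_sign_eq_0:
  assumes net: "tms_net t m s x" and ne: "u \<noteq> {}" and u: "u \<subseteq> {1..s}" and i: "i < 2 ^ m"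
    and small: "sum k u + card u + t \<le> m"
  shows "(\<Sum>i'<2 ^ m. \<Prod>j\<in>u. gain_sign (x i j) (x i' j) (k j)) = 0"
proof -
  have fin: "finite u" using u finite_subset by blast
  \<comment> \<open>\<open>D v\<close> holds the depths tested by the term of the expansion in which
    exactly the coordinates in \<open>v\<close> contribute their deeper indicator.\<close>
  define D where "D v j = (if j \<in> v then Suc (k j) else k j)" for v j
  define E where "E l i' \<longleftrightarrow> (\<forall>j\<in>u. \<lfloor>2 ^ l j * x i j\<rfloor> = \<lfloor>2 ^ l j * x i' j\<rfloor>)" for l i'
  have range: "x p j \<in> {0..<1}" if "p < 2 ^ m" "j \<in> u" for p j
    using net that u unfolding tms_net_def by blast
  have expand: "(\<Prod>j\<in>u. gain_sign (x i j) (x p j) (k j)) =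
      (\<Sum>v\<in>Pow u. 2 ^ card v * (- 1) ^ card (u - v) * of_bool (E (D v) p))"
    if p: "p < 2 ^ m" for p
  proof -
    let ?B = "\<lambda>l j. of_bool (\<lfloor>2 ^ l * x i j\<rfloor> = \<lfloor>2 ^ l * x p j\<rfloor>) :: real"
    have "(\<Prod>j\<in>u. gain_sign (x i j) (x p j) (k j)) =
        (\<Prod>j\<in>u. 2 * ?B (Suc (k j)) j + (- 1) * ?B (k j) j)"
      using range[OF i] range[OF p] by (intro prod.cong) (simp_all add: gain_sign_eq)
    also have "\<dots> = (\<Sum>v\<in>Pow u. (\<Prod>j\<in>v. 2 * ?B (Suc (k j)) j) * (\<Prod>j\<in>u - v. (- 1) * ?B (k j) j))"
      by (rule prod_add[OF fin])
    also have "\<dots> = (\<Sum>v\<in>Pow u. 2 ^ card v * (- 1) ^ card (u - v) * of_bool (E (D v) p))"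
    proof (rule sum.cong[OF refl])
      fix v assume "v \<in> Pow u"
      then have v: "v \<subseteq> u" by simp
      have "of_bool (E (D v) p) = (\<Prod>j\<in>u. ?B (D v j) j)"
        by (simp add: E_def prod_of_bool[OF fin])
      also have "\<dots> = (\<Prod>j\<in>u - v. ?B (D v j) j) * (\<Prod>j\<in>v. ?B (D v j) j)"
        by (rule prod.subset_diff[OF v fin])
      also have "\<dots> = (\<Prod>j\<in>u - v. ?B (k j) j) * (\<Prod>j\<in>v. ?B (Suc (k j)) j)"
        by (simp add: D_def)
      finally show "(\<Prod>j\<in>v. 2 * ?B (Suc (k j)) j) * (\<Prod>j\<in>u - v. (- 1) * ?B (k j) j) =
          2 ^ card v * (- 1) ^ card (u - v) * of_bool (E (D v) p)"
        unfolding prod.distrib by (simp only: prod_constant mult_ac)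
    qed
    finally show ?thesis .
  qed
  \<comment> \<open>Each extra level of depth halves the count, which the coefficient
    \<open>2 ^ card v\<close> undoes: up to sign, all terms are equal.\<close>
  have count: "(\<Sum>p<2 ^ m. of_bool (E (D v) p)) * 2 ^ card v = (2 ^ (m - sum k u) :: real)"
    if v: "v \<subseteq> u" for v
  proof -
    have "sum (D v) u = sum k u + card v"
    proof -
      have "sum (D v) u = (\<Sum>j\<in>u. k j + of_bool (j \<in> v))"
        by (rule sum.cong) (auto simp: D_def)
      then show ?thesis
        using v fin by (simp add: sum.distrib Int_absorb1)
    qed
    \<comment> \<open>With \<open>small\<close>, this keeps the total depth of \<open>D v\<close>
      within \<open>m - t\<close>.\<close>
    moreover have "card v \<le> card u" using v fin by (rule card_mono[rotated])
    ultimately have "card {p. p < 2 ^ m \<and> E (D v) p} = 2 ^ (m - (sum k u + card v))"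
      using card_same_box[OF net u i, of "D v"] small unfolding E_def by simp
    moreover have "(\<Sum>p<2 ^ m. of_bool (E (D v) p)) = real (card {p. p < 2 ^ m \<and> E (D v) p})"
      by (simp add: Int_def)
    moreover have "m - (sum k u + card v) + card v = m - sum k u"
      using \<open>card v \<le> card u\<close> small by simp
    ultimately show ?thesis by (simp flip: power_add)
  qed
  have "(\<Sum>p<2 ^ m. \<Prod>j\<in>u. gain_sign (x i j) (x p j) (k j)) =
      (\<Sum>p<2 ^ m. \<Sum>v\<in>Pow u. 2 ^ card v * (- 1) ^ card (u - v) * of_bool (E (D v) p))"
    by (rule sum.cong) (simp_all add: expand)
  also have "\<dots> = (\<Sum>v\<in>Pow u. (- 1) ^ card (u - v) *
      ((\<Sum>p<2 ^ m. of_bool (E (D v) p)) * 2 ^ card v))"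
    by (subst sum.swap) (simp add: sum_distrib_left sum_distrib_right mult_ac)
  also have "\<dots> = (\<Sum>v\<in>Pow u. (- 1) ^ card (u - v)) * 2 ^ (m - sum k u)"
    by (subst sum_distrib_right, rule sum.cong) (auto simp only: count Pow_iff)
  \<comment> \<open>The alternating sum is the expanded product of the factors
    \<open>1 + (- 1)\<close> over the nonempty set \<open>u\<close>.\<close>
  also have "(\<Sum>v\<in>Pow u. (- 1) ^ card (u - v)) = (0 :: real)"
    using prod_add[OF fin, of "\<lambda>_. 1" "\<lambda>_. - 1 :: real"] fin ne by (simp add: power_0_left)
  finally show ?thesis by simp
qed

lemma sum_gain_sign_le:
  assumes tm: "t \<le> m" and net: "tms_net t m s x" and u: "u \<subseteq> {1..s}" and i: "i < 2 ^ m"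
    and large: "m < sum k u + card u + t" and ne: "u \<noteq> {}"
  shows "(\<Sum>i'<2 ^ m. \<Prod>j\<in>u. gain_sign (x i j) (x i' j) (k j)) \<le> 2 ^ (t + card u - 1)"
proof -
  have fin: "finite u" using u finite_subset by blast
  have range: "x p j \<in> {0..<1}" if "p < 2 ^ m" "j \<in> u" for p j
    using net that u unfolding tms_net_def by blast
  \<comment> \<open>The cap \<open>m - t\<close> is the largest total depth at which the net
    property counts points.\<close>
  obtain l where l: "\<And>j. l j \<le> k j" "sum l u = min (sum k u) (m - t)"
    using ex_le_with_sum[OF fin, of "min (sum k u) (m - t)" k] by auto
  let ?E = "\<lambda>p. \<forall>j\<in>u. \<lfloor>2 ^ l j * x i j\<rfloor> = \<lfloor>2 ^ l j * x p j\<rfloor>"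
  have "(\<Prod>j\<in>u. gain_sign (x i j) (x p j) (k j)) \<le> of_bool (?E p)" if p: "p < 2 ^ m" for p
  proof -
    \<comment> \<open>Agreement at depth \<open>Suc (k j)\<close> forces agreement at
      \<open>k j\<close>, which excludes the value 2; a nonzero sign forces agreement at the coarser
      depth \<open>l j\<close>.\<close>
    have "\<bar>gain_sign (x i j) (x p j) (k j)\<bar> \<le> of_bool (\<lfloor>2 ^ l j * x i j\<rfloor> = \<lfloor>2 ^ l j * x p j\<rfloor>)"
      if j: "j \<in> u" for j
      using floor_power2_mono[of "Suc (k j)" "x i j" "x p j" "k j"]
        floor_power2_mono[OF _ l(1), of j "x i j" "x p j"]
      unfolding gain_sign_eq[OF range[OF i j] range[OF p j]] by (auto simp del: power_Suc)
    then have "\<bar>\<Prod>j\<in>u. gain_sign (x i j) (x p j) (k j)\<bar> \<le>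
        (\<Prod>j\<in>u. of_bool (\<lfloor>2 ^ l j * x i j\<rfloor> = \<lfloor>2 ^ l j * x p j\<rfloor>))"
      unfolding abs_prod by (intro prod_mono) auto
    then show ?thesis unfolding prod_of_bool[OF fin] by linarith
  qed
  then have "(\<Sum>p<2 ^ m. \<Prod>j\<in>u. gain_sign (x i j) (x p j) (k j)) \<le> (\<Sum>p<2 ^ m. of_bool (?E p))"
    by (intro sum_mono) auto
  also have "\<dots> = real (card {p. p < 2 ^ m \<and> ?E p})" by (simp add: Int_def)
  also have "\<dots> = 2 ^ (m - sum l u)"
    using card_same_box[OF net u i, of l] l(2) tm by simp
  also have "\<dots> \<le> 2 ^ (t + card u - 1)"
  proof (rule power_increasing)
    have "0 < card u" using fin ne by (simp add: card_gt_0_iff)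
    \<comment> \<open>If the minimum is \<open>m - t\<close>, the left side is \<open>t\<close> and
      \<open>0 < card u\<close> suffices; if it is \<open>sum k u\<close>, the strict inequality
      \<open>large\<close> provides the \<open>- 1\<close>.\<close>
    then show "m - sum l u \<le> t + card u - 1" using l(2) large tm by simp
  qed simp
  finally show ?thesis .
qed

theorem corollary3:
  fixes t m s :: nat
    and x :: "nat \<Rightarrow> nat \<Rightarrow> real"
    and u :: "nat set"
    and k :: "nat \<Rightarrow> nat"
  assumes "t \<le> m"
    and "1 \<le> s"
    and "tms_net t m s x"
    and "u \<noteq> {}"
    and "u \<subseteq> {1..s}"
  shows "gain_coeff (2 ^ m) x u k \<le> 2 ^ (t + card u - 1)"
proof -
  have "(\<Sum>i'<2 ^ m. \<Prod>j\<in>u. gain_sign (x i j) (x i' j) (k j)) \<le> 2 ^ (t + card u - 1)"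
    if "i < 2 ^ m" for i
  proof (cases "sum k u + card u + t \<le> m")
    case True
    then show ?thesis using sum_gain_sign_eq_0[OF assms(3-5) that] by simp
  next
    case False
    then show ?thesis using sum_gain_sign_le[OF assms(1,3,5) that] assms(4) by simp
  qed
  \<comment> \<open>The bound is uniform in the first point, so averaging over the
    \<open>2 ^ m\<close> points preserves it.\<close>
  then have "(\<Sum>i<2 ^ m. \<Sum>i'<2 ^ m. \<Prod>j\<in>u. gain_sign (x i j) (x i' j) (k j)) \<le>
      (\<Sum>i<(2::nat) ^ m. 2 ^ (t + card u - 1))"
    by (intro sum_mono) auto
  then show ?thesis unfolding gain_coeff_def by (simp add: field_simps)
qed

end
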